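(* Let $k,t,q$ be integers such that $q\ge 2$ and $k>t\ge 2$, and let $s\ge 0$ be an integer. If $s<\bigl(R_q(k-t+1,k,\ldots,k)-q(k-t)\bigr)/(qt)$, then $K_k$ and $K_k+sK_t$ are $q$-equivalent.
   Context: All graphs are finite and simple. $K_k+sK_t$ denotes the vertex-disjoint union of a copy of $K_k$ and $s$ copies of $K_t$. For integers $q\ge 2$ and $k_1,\dots,k_q\ge 2$, $R(k_1,\dots,k_q)$ is the smallest $n$ such that every colouring of the edges of $K_n$ with colours $[q]$ contains, for some $i\in[q]$, a copy of $K_{k_i}$ all of whose edges have colour $i$; $R_q(k_1,k_2,\ldots,k_2)$ denotes $R(k_1,\dots,k_q)$ with $k_2=\dots=k_q$. A graph $G$ is $q$-Ramsey for $H$ if every $q$-colouring of $E(G)$ contains a monochromatic copy of $H$; $G$ is $q$-Ramsey-minimal for $H$ if it is $q$-Ramsey for $H$ but no proper subgraph is; $\mathcal{M}_q(H)$ is the set of such graphs. $H,H'$ are $q$-equivalent if $\mathcal{M}_q(H)=\mathcal{M}_q(H')$. *)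

theory Defs
  imports Complex_Main "HOL-Library.Ramsey"
begin

record 'a ugraph =
  verts :: "'a set"
  edges :: "'a set set"

definition simple_graph :: "'a ugraph \<Rightarrow> bool" where
  "simple_graph G \<longleftrightarrow> finite (verts G) \<and> edges G \<subseteq> nsets (verts G) 2"

definition subgraph :: "'a ugraph \<Rightarrow> 'a ugraph \<Rightarrow> bool" where
  "subgraph H G \<longleftrightarrow>
     simple_graph H \<and> simple_graph G \<and> verts H \<subseteq> verts G \<and> edges H \<subseteq> edges G"

definition graph_iso :: "'a ugraph \<Rightarrow> 'b ugraph \<Rightarrow> bool" where
  "graph_iso G H \<longleftrightarrow>
     (\<exists>f. bij_betw f (verts G) (verts H) \<and> edges H = (\<lambda>e. f ` e) ` edges G)"

definition complete_graph :: "nat \<Rightarrow> nat ugraph" where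
  "complete_graph n = \<lparr>verts = {..<n}, edges = nsets {..<n} 2\<rparr>"

definition disjoint_union :: "'a ugraph \<Rightarrow> 'b ugraph \<Rightarrow> ('a + 'b) ugraph" where
  "disjoint_union G H =
     \<lparr>verts = verts G <+> verts H,
      edges = (\<lambda>e. Inl ` e) ` edges G \<union> (\<lambda>e. Inr ` e) ` edges H\<rparr>"

definition disjoint_copies :: "nat \<Rightarrow> 'a ugraph \<Rightarrow> (nat \<times> 'a) ugraph" where
  "disjoint_copies s G =
     \<lparr>verts = {..<s} \<times> verts G,
      edges = (\<Union>i<s. (\<lambda>e. Pair i ` e) ` edges G)\<rparr>"

text \<open>Colours are \<open>0, \<dots>, q - 1\<close>. A copy is a subgraph, not necessarily induced.\<close>

definition is_ramsey_for :: "nat \<Rightarrow> 'a ugraph \<Rightarrow> 'b ugraph \<Rightarrow> bool" where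
  "is_ramsey_for q G H \<longleftrightarrow>
     simple_graph G \<and>
     (\<forall>c \<in> edges G \<rightarrow> {..<q}.
        \<exists>H'. subgraph H' G \<and> graph_iso H H' \<and> (\<exists>i<q. \<forall>e \<in> edges H'. c e = i))"

definition is_ramsey_minimal_for :: "nat \<Rightarrow> 'a ugraph \<Rightarrow> 'b ugraph \<Rightarrow> bool" where
  "is_ramsey_minimal_for q G H \<longleftrightarrow>
     is_ramsey_for q G H \<and>
     (\<forall>G'. subgraph G' G \<and> G' \<noteq> G \<longrightarrow> \<not> is_ramsey_for q G' H)"

text \<open>Vertices are taken in \<^typ>\<open>nat\<close>: up to isomorphism this covers all finite graphs, and
  it lets graphs \<open>H\<close>, \<open>H'\<close> with different vertex types be compared.\<close>

definition ramsey_minimal_graphs :: "nat \<Rightarrow> 'b ugraph \<Rightarrow> nat ugraph set" where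
  "ramsey_minimal_graphs q H = {G. is_ramsey_minimal_for q G H}"

definition ramsey_equivalent :: "nat \<Rightarrow> 'a ugraph \<Rightarrow> 'b ugraph \<Rightarrow> bool" where
  "ramsey_equivalent q H H' \<longleftrightarrow> ramsey_minimal_graphs q H = ramsey_minimal_graphs q H'"

text \<open>\<open>R(k\<^sub>1, \<dots>, k\<^sub>q)\<close> for the list \<open>ks = [k\<^sub>1, \<dots>, k\<^sub>q]\<close>; the minimum exists by
  \<open>ramsey_full\<close>.\<close>

definition ramsey_number :: "nat list \<Rightarrow> nat" where
  "ramsey_number ks = (LEAST n. partn_lst {..<n} ks 2)"

end

theory Submission
  imports Defs
begin

text \<open>
  Only one implication is not immediate: if \<open>G\<close> is \<open>q\<close>-Ramsey for \<open>K\<^sub>k\<close>, then it is so for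
  \<open>K\<^sub>k + s K\<^sub>t\<close>. Suppose a colouring of \<open>G\<close> has no monochromatic \<open>K\<^sub>k + s K\<^sub>t\<close>. For every colour
  that has a monochromatic \<open>K\<^sub>k\<close>, this \<open>K\<^sub>k\<close> together with a maximal family of disjoint
  monochromatic copies of \<open>K\<^sub>t\<close> outside it is a set of at most \<open>k + (s - 1) t\<close> vertices that
  meets all copies of \<open>K\<^sub>t\<close> of that colour. The union \<open>U\<close> of these sets has fewer than
  \<open>R(k - t + 1, k, \<dots>, k)\<close> vertices. Fix a colour \<open>p\<close> with a monochromatic \<open>K\<^sub>k\<close>, recolour the
  edges inside \<open>U\<close> without a \<open>K\<^bsub>k-t+1\<^esub>\<close> of colour \<open>p\<close> and without a \<open>K\<^sub>k\<close> of any
  other colour, and give colour \<open>p\<close> to all edges between \<open>U\<close> and its complement. A clique of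
  colour \<open>p\<close> now has at most \<open>k - t\<close> vertices in \<open>U\<close> and at most \<open>t - 1\<close> outside, so there is no
  monochromatic \<open>K\<^sub>k\<close> at all, a contradiction.
\<close>

section \<open>Monochromatic copies as vertex sets\<close>

definition mono_cliques :: "'a ugraph \<Rightarrow> ('a set \<Rightarrow> nat) \<Rightarrow> nat \<Rightarrow> nat \<Rightarrow> 'a set set" where
  "mono_cliques G c i m = {S \<in> nsets (verts G) m. \<forall>e \<in> nsets S 2. e \<in> edges G \<and> c e = i}"

lemma mono_cliquesD:
  assumes "S \<in> mono_cliques G c i m"
  shows "S \<subseteq> verts G" "finite S" "card S = m"
    and "\<And>e. e \<in> nsets S 2 \<Longrightarrow> e \<in> edges G" "\<And>e. e \<in> nsets S 2 \<Longrightarrow> c e = i"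
  using assms by (auto simp: mono_cliques_def nsets_def)

lemma mono_cliques_subset:
  assumes "S \<in> mono_cliques G c i m" "S' \<subseteq> S"
  shows "S' \<in> mono_cliques G c i (card S')"
  using assms nsets_mono[of S' S 2] finite_subset[of S' S]
  by (auto simp: mono_cliques_def nsets_def)

lemma image_nsets_eq:
  assumes "inj_on f A"
  shows "(\<lambda>e. f ` e) ` nsets A n = nsets (f ` A) n"
  using bij_betw_nsets[OF inj_on_imp_bij_betw[OF assms]] by (simp add: bij_betw_def)

text \<open>Only inclusions are asked of \<open>f\<close>, so that it can be an isomorphism from
  \<open>K_k\<close> or the restriction to the first summand of an isomorphism from a disjoint
  union.\<close>

lemma copy_imp_mono_clique:
  assumes "subgraph H' G" "\<forall>e \<in> edges H'. c e = i"
    and "inj_on f {..<k}" "f ` {..<k} \<subseteq> verts H'"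
    and "(\<lambda>e. f ` e) ` nsets {..<k} 2 \<subseteq> edges H'"
  shows "f ` {..<k} \<in> mono_cliques G c i k"
  using assms unfolding image_nsets_eq[OF assms(3)]
  by (auto simp: mono_cliques_def subgraph_def nsets_def card_image)

text \<open>Trades subgraphs up to isomorphism for vertex sets: any enumeration of a clique is an
  isomorphism from \<open>complete_graph k\<close> onto the graph of all its pairs.\<close>

lemma complete_copy_iff:
  assumes "simple_graph G"
  shows "(\<exists>H'. subgraph H' G \<and> graph_iso (complete_graph k) H' \<and> (\<forall>e \<in> edges H'. c e = i))
    \<longleftrightarrow> mono_cliques G c i k \<noteq> {}" (is "?L \<longleftrightarrow> ?R")
proof
  assume ?L
  then obtain H' f where "subgraph H' G" "\<forall>e \<in> edges H'. c e = i"
    and "bij_betw f {..<k} (verts H')" "edges H' = (\<lambda>e. f ` e) ` nsets {..<k} 2"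
    by (auto simp: graph_iso_def complete_graph_def)
  then have "f ` {..<k} \<in> mono_cliques G c i k"
    by (intro copy_imp_mono_clique) (auto simp: bij_betw_def)
  then show ?R by blast
next
  assume ?R
  then obtain S where S: "S \<in> mono_cliques G c i k" by blast
  note SD = mono_cliquesD[OF S]
  obtain f where f: "bij_betw f {..<k} S"
    using ex_bij_betw_nat_finite[OF SD(2)] SD(3) by (auto simp: atLeast0LessThan)
  let ?H = "\<lparr>verts = S, edges = nsets S 2\<rparr>"
  have "subgraph ?H G"
    using SD assms by (auto simp: subgraph_def simple_graph_def)
  moreover have "graph_iso (complete_graph k) ?H"
    using f bij_betw_nsets[OF f, of 2]
    by (auto simp: graph_iso_def complete_graph_def bij_betw_def intro!: exI[of _ f])
  ultimately show ?L using SD(5) by (intro exI[of _ ?H]) auto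
qed

lemma union_copy_imp_mono_clique:
  assumes "subgraph H' G" "\<forall>e \<in> edges H'. c e = i"
    and "graph_iso (disjoint_union (complete_graph k) X) H'"
  shows "mono_cliques G c i k \<noteq> {}"
proof -
  obtain f where f: "bij_betw f ({..<k} <+> verts X) (verts H')"
    and E: "edges H' = (\<lambda>e. f ` e) ` ((\<lambda>e. Inl ` e) ` nsets {..<k} 2 \<union> (\<lambda>e. Inr ` e) ` edges X)"
    using assms(3) by (auto simp: graph_iso_def disjoint_union_def complete_graph_def)
  have "(f \<circ> Inl) ` {..<k} \<in> mono_cliques G c i k"
  proof (rule copy_imp_mono_clique[OF assms(1,2)])
    show "inj_on (f \<circ> Inl) {..<k}"
      using f by (auto simp: bij_betw_def inj_on_def Plus_def)
    show "(f \<circ> Inl) ` {..<k} \<subseteq> verts H'"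
      using f by (auto simp: bij_betw_def Plus_def)
    show "(\<lambda>e. (f \<circ> Inl) ` e) ` nsets {..<k} 2 \<subseteq> edges H'"
      unfolding E by (auto simp: image_comp[symmetric])
  qed
  then show ?thesis by blast
qed

lemma mono_cliques_imp_union_copy:
  assumes G: "simple_graph G" and S: "S \<in> mono_cliques G c i k"
    and T: "\<And>j. j < s \<Longrightarrow> T j \<in> mono_cliques G c i t"
    and ST: "\<And>j. j < s \<Longrightarrow> T j \<inter> S = {}"
    and TT: "\<And>j j'. j < s \<Longrightarrow> j' < s \<Longrightarrow> j \<noteq> j' \<Longrightarrow> T j \<inter> T j' = {}"
  shows "\<exists>H'. subgraph H' G
    \<and> graph_iso (disjoint_union (complete_graph k) (disjoint_copies s (complete_graph t))) H'
    \<and> (\<forall>e \<in> edges H'. c e = i)"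
proof -
  note SD = mono_cliquesD[OF S] and TD = mono_cliquesD[OF T]
  obtain g where g: "bij_betw g {..<k} S"
    using ex_bij_betw_nat_finite[OF SD(2)] SD(3) by (auto simp: atLeast0LessThan)
  have "\<forall>j. \<exists>h. j < s \<longrightarrow> bij_betw h {..<t} (T j)"
    using ex_bij_betw_nat_finite[OF TD(2)] TD(3) by (metis atLeast0LessThan)
  then obtain h where h: "\<And>j. j < s \<Longrightarrow> bij_betw (h j) {..<t} (T j)" by metis
  \<comment> \<open>The edges of \<open>G\<close> between the parts may have any colour and are left
    out, since a copy need not be induced.\<close>
  let ?H = "\<lparr>verts = S \<union> (\<Union>j<s. T j), edges = nsets S 2 \<union> (\<Union>j<s. nsets (T j) 2)\<rparr>"
  have "simple_graph ?H"
    using SD(2) TD(2) by (auto simp: simple_graph_def nsets_def)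
  then have "subgraph ?H G"
    using SD(1,4) TD(1,4) G by (auto simp: subgraph_def)
  moreover have "graph_iso (disjoint_union (complete_graph k) (disjoint_copies s (complete_graph t))) ?H"
  proof -
    let ?f = "case_sum g (\<lambda>(j, x). h j x)"
    have gS: "g ` {..<k} = S" and hT: "\<And>j. j < s \<Longrightarrow> h j ` {..<t} = T j"
      using g h by (auto simp: bij_betw_def)
    have "inj_on ?f ({..<k} <+> {..<s} \<times> {..<t})"
    proof (rule inj_onI)
      fix a b
      assume ab: "a \<in> {..<k} <+> {..<s} \<times> {..<t}" "b \<in> {..<k} <+> {..<s} \<times> {..<t}" "?f a = ?f b"
      have gh: "g x \<noteq> h j y" if "x < k" "j < s" "y < t" for x j y
        using that gS hT[of j] ST[of j] by blast
      have gg: "x = x'" if "g x = g x'" "x < k" "x' < k" for x x'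
        using that g by (auto simp: bij_betw_def inj_on_def)
      have hh: "j = j' \<and> y = y'" if eq: "h j y = h j' y'" and lt: "j < s" "j' < s" "y < t" "y' < t"
        for j j' y y'
      proof -
        have "j = j'" using eq lt hT[of j] hT[of j'] TT[of j j'] by blast
        moreover from this have "y = y'" using eq lt h[of j] by (auto simp: bij_betw_def inj_on_def)
        ultimately show ?thesis ..
      qed
      show "a = b"
      proof (cases a; cases b)
        fix u v assume "a = Inl u" "b = Inl v"
        then show ?thesis using ab gg by auto
      next
        fix u v assume "a = Inl u" "b = Inr v"
        then show ?thesis using ab gh by (cases v) auto
      next
        fix u v assume "a = Inr u" "b = Inl v"
        then show ?thesis using ab gh[of v "fst u" "snd u"] by (cases u) auto
      next
        fix u v assume "a = Inr u" "b = Inr v"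
        then show ?thesis using ab hh by (cases u; cases v) auto
      qed
    qed
    moreover have "?f ` ({..<k} <+> {..<s} \<times> {..<t}) = S \<union> (\<Union>j<s. T j)"
    proof -
      have "?f ` ({..<k} <+> {..<s} \<times> {..<t}) = g ` {..<k} \<union> (\<Union>j<s. h j ` {..<t})"
        by (auto simp: Plus_def image_Un image_image)
      then show ?thesis using gS hT by simp
    qed
    moreover have "nsets S 2 \<union> (\<Union>j<s. nsets (T j) 2) = (\<lambda>e. ?f ` e) `
      ((\<lambda>e. Inl ` e) ` nsets {..<k} 2 \<union> (\<lambda>e. Inr ` e) ` (\<Union>j<s. (\<lambda>e. Pair j ` e) ` nsets {..<t} 2))"
    proof -
      have "nsets S 2 = (\<lambda>e. g ` e) ` nsets {..<k} 2"
        using bij_betw_nsets[OF g] by (simp add: bij_betw_def)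
      moreover have "nsets (T j) 2 = (\<lambda>e. h j ` e) ` nsets {..<t} 2" if "j < s" for j
        using bij_betw_nsets[OF h[OF that]] by (simp add: bij_betw_def)
      ultimately show ?thesis
        by (simp add: image_Un image_image image_UN)
    qed
    ultimately show ?thesis
      unfolding graph_iso_def disjoint_union_def disjoint_copies_def complete_graph_def bij_betw_def
      by (intro exI[of _ ?f]) simp
  qed
  ultimately show ?thesis
    using SD(5) TD(5) by (intro exI[of _ ?H]) auto
qed

section \<open>Disjoint families and small transversals\<close>

text \<open>Greedy choice: if no member of \<open>P\<close> avoids \<open>S\<close> and the sets
  chosen so far, then these sets together meet all of \<open>P\<close>. At most \<open>s - 1\<close>
  sets were chosen by then; adding \<open>t\<close> on the left of the bound avoids this
  subtraction.\<close>

lemma disjoint_family_or_transversal: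
  assumes "finite S" and P: "\<And>T. T \<in> P \<Longrightarrow> finite T \<and> card T = t"
  shows "(\<exists>T. (\<forall>j<s. T j \<in> P \<and> T j \<inter> S = {}) \<and> (\<forall>j<s. \<forall>j'<s. j \<noteq> j' \<longrightarrow> T j \<inter> T j' = {}))
    \<or> (\<exists>U. finite U \<and> card U + t \<le> card S + s * t \<and> (\<forall>T\<in>P. T \<inter> U \<noteq> {}))"
proof (induction s)
  case 0
  show ?case by simp
next
  case (Suc s)
  from Suc.IH show ?case
  proof (elim disjE exE)
    fix U assume "finite U \<and> card U + t \<le> card S + s * t \<and> (\<forall>T\<in>P. T \<inter> U \<noteq> {})"
    \<comment> \<open>A transversal found earlier still serves, as the bound grows with
      \<open>s\<close>.\<close>
    then show ?thesis by (intro disjI2 exI[of _ U]) auto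
  next
    fix T :: "nat \<Rightarrow> 'a set"
    assume T: "(\<forall>j<s. T j \<in> P \<and> T j \<inter> S = {}) \<and> (\<forall>j<s. \<forall>j'<s. j \<noteq> j' \<longrightarrow> T j \<inter> T j' = {})"
    let ?U = "S \<union> (\<Union>j<s. T j)"
    have fin: "finite ?U" using assms(1) P T by auto
    have "card (\<Union>j<s. T j) \<le> (\<Sum>j<s. card (T j))" by (rule card_UN_le) simp
    also have "\<dots> = s * t" using P T by simp
    finally have cU: "card ?U \<le> card S + s * t"
      using card_Un_le[of S "\<Union>j<s. T j"] by linarith
    show ?thesis
    proof (cases "\<exists>X\<in>P. X \<inter> ?U = {}")
      case True
      then obtain X where X: "X \<in> P" "X \<inter> ?U = {}" by blast
      then have "X \<inter> T j = {}" if "j < s" for j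
        using that by blast
      with T X show ?thesis
        by (intro disjI1 exI[of _ "T(s := X)"]) (auto simp: less_Suc_eq Int_commute)
    next
      case False
      with fin cU show ?thesis by (intro disjI2 exI[of _ ?U]) auto
    qed
  qed
qed

section \<open>Recolouring\<close>

text \<open>Minimality of the Ramsey number gives a good colouring of the pairs of
  \<open>{..<card U}\<close>, which a bijection carries to \<open>U\<close>. There the special size
  \<open>a\<close> belongs to colour 0, so the colours are permuted to give it to
  \<open>p\<close>.\<close>

lemma below_ramsey_number:
  assumes U: "finite U" "card U < ramsey_number (a # replicate (q - 1) b)" and p: "p < q"
  shows "\<exists>d. d \<in> nsets U 2 \<rightarrow> {..<q} \<and>
    (\<forall>i<q. \<forall>S\<in>nsets U (if i = p then a else b). \<not> d ` nsets S 2 \<subseteq> {i})"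
proof -
  let ?ks = "a # replicate (q - 1) b" and ?n = "card U"
  have "\<not> partn_lst {..<?n} ?ks 2"
    using U(2) not_less_Least unfolding ramsey_number_def by blast
  then obtain f where f: "f \<in> nsets {..<?n} 2 \<rightarrow> {..<q}"
    and nomono: "\<And>i H. i < q \<Longrightarrow> H \<in> nsets {..<?n} (?ks ! i) \<Longrightarrow> \<not> f ` nsets H 2 \<subseteq> {i}"
    using p unfolding partn_lst_def monochromatic_def by auto
  obtain h where h: "bij_betw h U {..<?n}"
    using ex_bij_betw_finite_nat[OF U(1)] by (auto simp: atLeast0LessThan)
  \<comment> \<open>The transposition of 0 and \<open>p\<close>: it sends \<open>p\<close> to the
    head of \<open>?ks\<close> and every other colour to an entry \<open>b\<close>.\<close>
  let ?\<pi> = "\<lambda>i. if i = p then 0 else if i = 0 then p else i"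
  have \<pi>: "?\<pi> (?\<pi> i) = i" "i < q \<Longrightarrow> ?\<pi> i < q" for i
    using p by auto
  let ?d = "\<lambda>e. ?\<pi> (f (h ` e))"
  have "h ` e \<in> nsets {..<?n} m" if "e \<in> nsets U m" for e m
    using bij_betw_nsets[OF h, of m] that by (auto simp: bij_betw_def)
  note hn = this
  have "?d \<in> nsets U 2 \<rightarrow> {..<q}"
    using f hn[of _ 2] \<pi>(2) by (auto simp: Pi_iff)
  moreover have "\<not> ?d ` nsets S 2 \<subseteq> {i}" if i: "i < q" and S: "S \<in> nsets U (if i = p then a else b)" for i S
  proof
    assume mono: "?d ` nsets S 2 \<subseteq> {i}"
    have "?ks ! ?\<pi> i = (if i = p then a else b)"
      using i p by (auto simp: nth_Cons')
    with hn S have "h ` S \<in> nsets {..<?n} (?ks ! ?\<pi> i)" by metis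
    moreover have "f ` nsets (h ` S) 2 \<subseteq> {?\<pi> i}"
    proof -
      have "inj_on h S"
        using h S by (auto simp: bij_betw_def nsets_def intro: inj_on_subset)
      then have "nsets (h ` S) 2 = (\<lambda>e. h ` e) ` nsets S 2"
        by (simp add: image_nsets_eq)
      moreover have "f (h ` e) = ?\<pi> i" if "e \<in> nsets S 2" for e
      proof -
        have "i = ?d e" using mono that by blast
        then show ?thesis by (simp only: \<pi>(1))
      qed
      ultimately show ?thesis by auto
    qed
    ultimately show False using nomono[OF \<pi>(2)[OF i]] by blast
  qed
  ultimately show ?thesis by blast
qed

text \<open>For a colour other than \<open>p\<close>, no clique edge crosses the boundary of
  \<open>U\<close>. A \<open>K_k\<close> of that colour inside \<open>U\<close> is excluded by
  \<open>d\<close>; one outside \<open>U\<close> was already present under \<open>c\<close> and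
  contains a \<open>K_t\<close> missing \<open>U\<close>, against \<open>meet\<close>. Hence
  \<open>meet\<close> is demanded only for colours that have a \<open>K_k\<close> under
  \<open>c\<close>.\<close>

lemma recolouring_without_mono_clique:
  assumes "simple_graph G" and c: "c \<in> edges G \<rightarrow> {..<q}" and p: "p < q" and t: "1 \<le> t" "t < k"
    and U: "finite U" "card U < ramsey_number ((k - t + 1) # replicate (q - 1) k)"
    and meet: "\<And>i T. i < q \<Longrightarrow> mono_cliques G c i k \<noteq> {} \<Longrightarrow> T \<in> mono_cliques G c i t \<Longrightarrow> T \<inter> U \<noteq> {}"
    and pk: "mono_cliques G c p k \<noteq> {}"
  shows "\<exists>c'. c' \<in> edges G \<rightarrow> {..<q} \<and> (\<forall>i<q. mono_cliques G c' i k = {})"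
proof -
  obtain d where d: "d \<in> nsets U 2 \<rightarrow> {..<q}"
    and nod: "\<And>i S. i < q \<Longrightarrow> S \<in> nsets U (if i = p then k - t + 1 else k) \<Longrightarrow> \<not> d ` nsets S 2 \<subseteq> {i}"
    using below_ramsey_number[OF U p] by blast
  define c' where "c' e = (if e \<subseteq> U then d e else if e \<inter> U = {} then c e else p)" for e
  have "c' e < q" if "e \<in> edges G" for e
  proof -
    have "e \<in> nsets U 2" if "e \<subseteq> U"
      using that \<open>e \<in> edges G\<close> assms(1) by (auto simp: simple_graph_def nsets_def)
    then show ?thesis using that c d p by (auto simp: c'_def Pi_iff)
  qed
  moreover have "mono_cliques G c' i k = {}" if i: "i < q" for i
  proof (rule ccontr)
    assume "mono_cliques G c' i k \<noteq> {}"
    then obtain S where S: "S \<in> mono_cliques G c' i k" by blast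
    note SD = mono_cliquesD[OF S]
    have inside: "\<not> X \<subseteq> U" if "X \<subseteq> S" "card X = (if i = p then k - t + 1 else k)" for X
    proof
      assume "X \<subseteq> U"
      then have "X \<in> nsets U (if i = p then k - t + 1 else k)"
        using that SD(2) finite_subset unfolding nsets_def by blast
      moreover have "d e = i" if "e \<in> nsets X 2" for e
      proof -
        have "e \<in> nsets S 2" "e \<subseteq> U"
          using that \<open>X \<subseteq> S\<close> \<open>X \<subseteq> U\<close> by (auto simp: nsets_def)
        then show ?thesis using SD(5)[of e] by (simp add: c'_def)
      qed
      ultimately show False using nod[OF i] by blast
    qed
    have outside: "X \<in> mono_cliques G c i (card X)" if "X \<subseteq> S" "X \<inter> U = {}" for X
    proof -
      have X: "X \<in> mono_cliques G c' i (card X)" by (rule mono_cliques_subset[OF S \<open>X \<subseteq> S\<close>])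
      moreover have "c e = c' e" if "e \<in> nsets X 2" for e
      proof -
        \<comment> \<open>The empty set would fall under the first case of \<open>c'\<close>; a
          nonempty \<open>e\<close> disjoint from \<open>U\<close> falls under the second.\<close>
        have "e \<subseteq> X" "e \<noteq> {}" using that by (auto simp: nsets_def)
        then show ?thesis using \<open>X \<inter> U = {}\<close> by (auto simp: c'_def)
      qed
      ultimately show ?thesis by (auto simp: mono_cliques_def)
    qed
    have few_outside: "card (S - U) < t" if "mono_cliques G c i k \<noteq> {}"
    proof (rule ccontr)
      assume "\<not> card (S - U) < t"
      then obtain X where X: "X \<subseteq> S - U" "card X = t"
        by (meson not_less obtain_subset_with_card_n)
      then have "X \<in> mono_cliques G c i t" "X \<inter> U = {}"
        using outside[of X] by auto
      then show False using meet[OF i that] by blast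
    qed
    show False
    proof (cases "i = p")
      case True
      have "card (S \<inter> U) \<le> k - t"
      proof (rule ccontr)
        assume "\<not> card (S \<inter> U) \<le> k - t"
        then have "k - t + 1 \<le> card (S \<inter> U)" by simp
        then obtain X where "X \<subseteq> S \<inter> U" "card X = k - t + 1"
          by (meson obtain_subset_with_card_n)
        then show False using inside[of X] True by auto
      qed
      moreover have "card (S - U) < t" using few_outside pk True by simp
      moreover have "card S = card (S \<inter> U) + card (S - U)"
        using SD(2) by (metis card_Int_Diff)
      ultimately show False using SD(3) t by linarith
    next
      case False
      have "S \<inter> U = {}"
      proof (rule ccontr)
        assume "S \<inter> U \<noteq> {}"
        then obtain x where x: "x \<in> S" "x \<in> U" by blast
        obtain y where y: "y \<in> S" "y \<notin> U" using inside[of S] SD(3) False by auto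
        have "{x, y} \<in> nsets S 2" using x y by auto
        then have "c' {x, y} = i" by (rule SD(5))
        then show False using x y False by (auto simp: c'_def)
      qed
      then have "S \<in> mono_cliques G c i k" using outside[of S] SD(3) by simp
      moreover have "card (S - U) = k" using \<open>S \<inter> U = {}\<close> SD(3) by (simp add: Diff_triv)
      ultimately show False using few_outside t by auto
    qed
  qed
  ultimately show ?thesis by (intro exI[of _ c']) auto
qed

section \<open>Passing between the two target graphs\<close>

text \<open>In \<open>lt\<close>, the factor \<open>k - t + s * t\<close> is the bound
  \<open>k + (s - 1) * t\<close> on the transversal of one colour, in a form that also makes sense
  for \<open>s = 0\<close>; \<open>q\<close> such sets make up \<open>U\<close>.\<close>

lemma ramsey_for_complete_imp_union:
  fixes G :: "'a ugraph"
  assumes t: "1 \<le> t" "t < k" and lt: "q * (k - t + s * t) < ramsey_number ((k - t + 1) # replicate (q - 1) k)"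
    and G: "is_ramsey_for q G (complete_graph k)"
  shows "is_ramsey_for q G (disjoint_union (complete_graph k) (disjoint_copies s (complete_graph t)))"
proof -
  let ?H = "disjoint_union (complete_graph k) (disjoint_copies s (complete_graph t))"
  have sG: "simple_graph G" using G by (simp add: is_ramsey_for_def)
  have clique: "\<exists>i<q. mono_cliques G c i k \<noteq> {}" if c: "c \<in> edges G \<rightarrow> {..<q}" for c
  proof -
    obtain H' i where "i < q" "subgraph H' G" "graph_iso (complete_graph k) H'"
      "\<forall>e \<in> edges H'. c e = i"
      using G c unfolding is_ramsey_for_def by blast
    then show ?thesis using complete_copy_iff[OF sG, of k c i] by blast
  qed
  have "\<exists>H'. subgraph H' G \<and> graph_iso ?H H' \<and> (\<exists>i<q. \<forall>e \<in> edges H'. c e = i)"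
    if c: "c \<in> edges G \<rightarrow> {..<q}" for c
  proof (rule ccontr)
    assume no: "\<not> ?thesis"
    have "\<exists>V. finite V \<and> card V \<le> k - t + s * t \<and>
      (mono_cliques G c i k \<noteq> {} \<longrightarrow> (\<forall>T\<in>mono_cliques G c i t. T \<inter> V \<noteq> {}))" if i: "i < q" for i
    proof (cases "mono_cliques G c i k = {}")
      case True
      \<comment> \<open>A colour without a \<open>K_k\<close> has nothing to meet and contributes no
        vertices.\<close>
      then show ?thesis by (intro exI[of _ "{}"]) auto
    next
      case False
      then obtain S where S: "S \<in> mono_cliques G c i k" by blast
      have fS: "finite S" and cS: "card S = k" using mono_cliquesD[OF S] by auto
      have fT: "finite T \<and> card T = t" if "T \<in> mono_cliques G c i t" for T
        using mono_cliquesD[OF that] by auto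
      have False if T: "\<forall>j<s. T j \<in> mono_cliques G c i t \<and> T j \<inter> S = {}"
        "\<forall>j<s. \<forall>j'<s. j \<noteq> j' \<longrightarrow> T j \<inter> T j' = {}" for T
      proof -
        have "\<exists>H'. subgraph H' G \<and> graph_iso ?H H' \<and> (\<forall>e \<in> edges H'. c e = i)"
          by (rule mono_cliques_imp_union_copy[where T = T, OF sG S]) (use T in simp_all)
        with no i show False by blast
      qed
      then obtain V where "finite V" "card V + t \<le> k + s * t"
        "\<forall>T\<in>mono_cliques G c i t. T \<inter> V \<noteq> {}"
        using disjoint_family_or_transversal[where P = "mono_cliques G c i t" and s = s, OF fS fT]
        unfolding cS by blast
      with t show ?thesis by (intro exI[of _ V]) auto
    qed
    then obtain V where V: "\<And>i. i < q \<Longrightarrow> finite (V i)" "\<And>i. i < q \<Longrightarrow> card (V i) \<le> k - t + s * t"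
      "\<And>i T. i < q \<Longrightarrow> mono_cliques G c i k \<noteq> {} \<Longrightarrow> T \<in> mono_cliques G c i t \<Longrightarrow> T \<inter> V i \<noteq> {}"
      by metis
    let ?U = "\<Union>i<q. V i"
    have "card ?U \<le> (\<Sum>i<q. card (V i))" by (rule card_UN_le) simp
    also have "\<dots> \<le> (\<Sum>i<q. k - t + s * t)" using V(2) by (intro sum_mono) simp
    also have "\<dots> = q * (k - t + s * t)" by simp
    finally have U: "card ?U < ramsey_number ((k - t + 1) # replicate (q - 1) k)"
      using lt by linarith
    obtain p where p: "p < q" "mono_cliques G c p k \<noteq> {}" using clique[OF c] by blast
    have "T \<inter> ?U \<noteq> {}" if "i < q" "mono_cliques G c i k \<noteq> {}" "T \<in> mono_cliques G c i t" for i T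
      using V(3)[OF that] that(1) by blast
    moreover have "finite ?U" using V(1) by simp
    ultimately have "\<exists>c'. c' \<in> edges G \<rightarrow> {..<q} \<and> (\<forall>i<q. mono_cliques G c' i k = {})"
      using recolouring_without_mono_clique[OF sG c p(1) t _ U _ p(2)] by blast
    then show False using clique by blast
  qed
  with sG show ?thesis by (simp add: is_ramsey_for_def)
qed

lemma ramsey_for_union_imp_complete:
  assumes G: "is_ramsey_for q G (disjoint_union (complete_graph k) X)"
  shows "is_ramsey_for q G (complete_graph k)"
  unfolding is_ramsey_for_def
proof (intro conjI ballI)
  show sG: "simple_graph G" using G by (simp add: is_ramsey_for_def)
  fix c assume "c \<in> edges G \<rightarrow> {..<q}"
  with G have "\<exists>H'. subgraph H' G \<and> graph_iso (disjoint_union (complete_graph k) X) H'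
      \<and> (\<exists>i<q. \<forall>e \<in> edges H'. c e = i)"
    by (simp only: is_ramsey_for_def)
  then obtain H' i where i: "i < q" and H': "subgraph H' G"
    "graph_iso (disjoint_union (complete_graph k) X) H'" "\<forall>e \<in> edges H'. c e = i"
    by (elim exE conjE)
  have "mono_cliques G c i k \<noteq> {}" by (rule union_copy_imp_mono_clique[OF H'(1,3,2)])
  then obtain H'' where "subgraph H'' G" "graph_iso (complete_graph k) H''"
    "\<forall>e \<in> edges H''. c e = i"
    unfolding complete_copy_iff[OF sG, symmetric] by (elim exE conjE)
  with i show "\<exists>H'. subgraph H' G \<and> graph_iso (complete_graph k) H'
      \<and> (\<exists>i<q. \<forall>e \<in> edges H'. c e = i)"
    by (intro exI[of _ H''] conjI exI[of _ i])
qed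

theorem theorem1p8:
  fixes k t q s :: nat
  assumes "q \<ge> 2" and "t \<ge> 2" and "k > t"
    and "real s <
      (real (ramsey_number ((k - t + 1) # replicate (q - 1) k)) - real q * (real k - real t))
        / (real q * real t)"
  shows "ramsey_equivalent q (complete_graph k)
    (disjoint_union (complete_graph k) (disjoint_copies s (complete_graph t)))"
proof -
  let ?R = "ramsey_number ((k - t + 1) # replicate (q - 1) k)"
  \<comment> \<open>Clearing the denominator turns the bound on \<open>s\<close> into
    \<open>q * (k - t + s * t) < ?R\<close>; as \<open>t < k\<close>, the subtraction on naturals
    agrees with the real one.\<close>
  have "0 < real q * real t" using assms by simp
  then have "real s * (real q * real t) < real ?R - real q * (real k - real t)"
    using assms(4) by (simp only: pos_less_divide_eq)
  moreover have "real (q * (k - t + s * t)) = real q * (real k - real t) + real s * (real q * real t)"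
  proof -
    have "real (k - t + s * t) = real k - real t + real s * real t"
      using assms(3) by simp
    then show ?thesis
      by (simp only: of_nat_mult) (simp add: algebra_simps)
  qed
  ultimately have "real (q * (k - t + s * t)) < real ?R" by linarith
  then have "q * (k - t + s * t) < ?R" by (simp only: of_nat_less_iff)
  then have "is_ramsey_for q G (complete_graph k) \<longleftrightarrow>
      is_ramsey_for q G (disjoint_union (complete_graph k) (disjoint_copies s (complete_graph t)))"
    for G :: "nat ugraph"
    using ramsey_for_complete_imp_union[of t k q s G] ramsey_for_union_imp_complete[of q G k] assms(2,3)
    by auto
  \<comment> \<open>Minimality refers to the target only through \<open>is_ramsey_for\<close>,
    applied to \<open>G\<close> and its subgraphs, so equal Ramsey graphs give equal minimal
    ones.\<close>
  then show ?thesis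
    by (simp add: ramsey_equivalent_def ramsey_minimal_graphs_def is_ramsey_minimal_for_def)
qed

end
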